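(* Let $K$ be a field, $S=K[x_1,\ldots,x_n]$, let $I\subset S$ be a monomial ideal with the non-pure dual exchange property, and let $\mathfrak{m}=(x_1,\ldots,x_n)$ be the unique graded maximal ideal of $S$. Then $\mathfrak{m}I$ also has the non-pure dual exchange property.
   Context: For a monomial ideal $I\subset S=K[x_1,\ldots,x_n]$, $G(I)$ denotes its unique minimal set of monomial generators. For a monomial $u$, $\deg_{x_i}(u)$ denotes the exponent of $x_i$ in $u$, and $\deg(u)$ its total degree. Non-pure dual exchange property: a monomial ideal $I$ satisfies the non-pure dual exchange property if, for all $u,v\in G(I)$ with $\deg(u)\leq \deg(v)$ and for all $i$ such that $\deg_{x_i}(v)<\deg_{x_i}(u)$, there exists $j$ such that $\deg_{x_j}(v)>\deg_{x_j}(u)$ and $x_i(v/x_j)\in I$. *)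

theory Defs
  imports Complex_Main "HOL-Library.Poly_Mapping"
begin

text \<open>
  A monomial is identified with its exponent vector; the index type \<open>'n\<close> of the variables is
  finite wherever it matters, and \<open>n = CARD('n)\<close>. The polynomial ring is the monoid algebra of
  the exponent vectors.
\<close>

type_synonym 'n mon = "'n \<Rightarrow>\<^sub>0 nat"
type_synonym ('n, 'k) mpoly = "'n mon \<Rightarrow>\<^sub>0 'k"

abbreviation expo :: "'n mon \<Rightarrow> 'n \<Rightarrow> nat" where
  "expo u i \<equiv> Poly_Mapping.lookup u i"

definition mdeg :: "'n::finite mon \<Rightarrow> nat" where
  "mdeg u = (\<Sum>i\<in>UNIV. expo u i)"

definition monom :: "'n mon \<Rightarrow> ('n, 'k::field) mpoly" where
  "monom u = Poly_Mapping.single u 1"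

definition var :: "'n \<Rightarrow> 'n mon" where
  "var i = Poly_Mapping.single i 1"

text \<open>Ideals are the submodules of a ring acting on itself.\<close>

interpretation ideal: module "(*) :: ('n, 'k::field) mpoly \<Rightarrow> ('n, 'k) mpoly \<Rightarrow> ('n, 'k) mpoly"
  by unfold_locales (auto simp: algebra_simps)

definition ideal_gen :: "('n, 'k::field) mpoly set \<Rightarrow> ('n, 'k) mpoly set" where
  "ideal_gen B = module.span (*) B"

definition ideal_mult ::
    "('n, 'k::field) mpoly set \<Rightarrow> ('n, 'k) mpoly set \<Rightarrow> ('n, 'k) mpoly set" where
  "ideal_mult I J = ideal_gen {p * q | p q. p \<in> I \<and> q \<in> J}"

definition max_ideal :: "('n, 'k::field) mpoly set" where
  "max_ideal = ideal_gen (range (\<lambda>i. monom (var i)))"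

definition monomial_ideal :: "('n, 'k::field) mpoly set \<Rightarrow> bool" where
  "monomial_ideal I \<longleftrightarrow> (\<exists>A. I = ideal_gen (monom ` A))"

definition minimal_monomial_gens :: "('n, 'k::field) mpoly set \<Rightarrow> 'n mon set \<Rightarrow> bool" where
  "minimal_monomial_gens I G \<longleftrightarrow>
     ideal_gen (monom ` G) = I \<and> (\<forall>H. H \<subset> G \<longrightarrow> ideal_gen (monom ` H) \<noteq> I)"

text \<open>
  Existence and uniqueness, for a monomial ideal, are shown in \<open>ex1_minimal_monomial_gens\<close> below.
\<close>

definition min_gens :: "('n, 'k::field) mpoly set \<Rightarrow> 'n mon set" where
  "min_gens I = (THE G. minimal_monomial_gens I G)"

text \<open>
  In \<open>v - var j + var i\<close> the truncated subtraction is a genuine division of monomials, because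
  \<open>expo v j > expo u j\<close> forces \<open>expo v j > 0\<close>.
\<close>

definition nonpure_dual_exchange :: "('n::finite, 'k::field) mpoly set \<Rightarrow> bool" where
  "nonpure_dual_exchange I \<longleftrightarrow>
     monomial_ideal I \<and>
     (\<forall>u\<in>min_gens I. \<forall>v\<in>min_gens I. mdeg u \<le> mdeg v \<longrightarrow>
        (\<forall>i. expo v i < expo u i \<longrightarrow>
           (\<exists>j. expo v j > expo u j \<and> monom (v - var j + var i) \<in> I)))"


lemma monom_mem_ideal_gen_iff:
  "(monom u :: ('n, 'k::field) mpoly) \<in> ideal_gen (monom ` A) \<longleftrightarrow> (\<exists>a\<in>A. \<exists>c. u = a + c)"
proof
  assume "(monom u :: ('n, 'k) mpoly) \<in> ideal_gen (monom ` A)"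
  then have "\<forall>w\<in>Poly_Mapping.keys (monom u :: ('n, 'k) mpoly). \<exists>a\<in>A. \<exists>c. w = a + c"
    unfolding ideal_gen_def
  proof (induction rule: ideal.span_induct_alt)
    case base
    show ?case by simp
  next
    case (step p q r)
    from step(1) obtain a where a: "a \<in> A" "q = monom a" by blast
    have "\<exists>a\<in>A. \<exists>c. w = a + c" if w: "w \<in> Poly_Mapping.keys (p * q)" for w
    proof -
      obtain s t where "w = s + t" "t \<in> Poly_Mapping.keys q"
        using w keys_mult[of p q] by blast
      then have "w = a + s" using a by (simp add: monom_def add.commute)
      then show ?thesis using a by blast
    qed
    then show ?case using step(2) keys_add[of "p * q" r] by blast
  qed
  then show "\<exists>a\<in>A. \<exists>c. u = a + c" by (simp add: monom_def)
next
  assume "\<exists>a\<in>A. \<exists>c. u = a + c"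
  then obtain a c where a: "a \<in> A" "u = a + c" by blast
  have "monom u = monom c * (monom a :: ('n, 'k) mpoly)"
    by (simp add: monom_def mult_single a add.commute)
  then show "(monom u :: ('n, 'k) mpoly) \<in> ideal_gen (monom ` A)"
    unfolding ideal_gen_def using a by (simp add: ideal.span_base ideal.span_scale)
qed

lemma ex1_minimal_monomial_gens:
  fixes I :: "('n::finite, 'k::field) mpoly set"
  assumes "monomial_ideal I"
  shows "\<exists>!G. minimal_monomial_gens I G"
proof -
  obtain A where A: "I = ideal_gen (monom ` A)"
    using assms unfolding monomial_ideal_def by blast
  define P where "P u \<longleftrightarrow> (monom u :: ('n, 'k) mpoly) \<in> I" for u
  define D where "D a u \<longleftrightarrow> (\<exists>c. u = a + c)" for a u :: "'n mon"
  define M where "M = {u. P u \<and> (\<forall>a. P a \<longrightarrow> D a u \<longrightarrow> a = u)}"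
  have trans: "D a c" if "D a b" "D b c" for a b c
    using that unfolding D_def by (metis add.assoc)
  have refl: "D a a" for a unfolding D_def by (metis add_0_right)
  have mdeg_add: "mdeg (a + c) = mdeg a + mdeg c" for a c :: "'n mon"
    by (simp add: mdeg_def lookup_add sum.distrib)
  have mdeg0: "c = 0" if "mdeg c = 0" for c :: "'n mon"
    using that by (intro poly_mapping_eqI) (simp add: mdeg_def)
  have eq: "a = u" if "D a u" "mdeg u \<le> mdeg a" for a u
    using that mdeg0 unfolding D_def by (auto simp: mdeg_add)
  have below: "\<exists>a\<in>M. D a u" if "P u" for u
    using that
  proof (induction "mdeg u" arbitrary: u rule: less_induct)
    case less
    show ?case
    proof (cases "u \<in> M")
      case True
      then show ?thesis using refl by blast
    next
      case False
      then obtain a where a: "P a" "D a u" "a \<noteq> u" using less(2) unfolding M_def by blast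
      then have "mdeg a < mdeg u" using eq by force
      then show ?thesis using less(1) a trans by blast
    qed
  qed
  have gen: "P u \<longleftrightarrow> (\<exists>a\<in>B. D a u)" if "ideal_gen (monom ` B) = I" for B u
    using monom_mem_ideal_gen_iff[of u B] that unfolding P_def D_def by blast
  have sub: "M \<subseteq> B" if B: "ideal_gen (monom ` B) = I" for B
  proof
    fix u assume u: "u \<in> M"
    then obtain a where a: "a \<in> B" "D a u" using gen[OF B] unfolding M_def by blast
    then have "P a" using gen[OF B] refl by blast
    then show "u \<in> B" using a u unfolding M_def by blast
  qed
  have memI: "monom u \<in> I \<longleftrightarrow> P u" for u unfolding P_def ..
  have genM: "ideal_gen (monom ` M) = I"
  proof (rule subset_antisym)
    have "monom ` M \<subseteq> I" using memI by (auto simp: M_def)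
    then show "ideal_gen (monom ` M) \<subseteq> I"
      unfolding A ideal_gen_def using ideal.span_minimal ideal.subspace_span by blast
    have "(monom ` A :: ('n, 'k) mpoly set) \<subseteq> ideal_gen (monom ` M)"
    proof (rule image_subsetI)
      fix a assume "a \<in> A"
      then have "P a" using gen[OF A[symmetric]] refl by blast
      then obtain b where "b \<in> M" "D b a" using below by blast
      then show "(monom a :: ('n, 'k) mpoly) \<in> ideal_gen (monom ` M)"
        unfolding monom_mem_ideal_gen_iff D_def by blast
    qed
    then show "I \<subseteq> ideal_gen (monom ` M)"
      unfolding A ideal_gen_def using ideal.span_minimal ideal.subspace_span by blast
  qed
  show ?thesis
  proof (rule ex1I[of _ M])
    show "minimal_monomial_gens I M"
      unfolding minimal_monomial_gens_def using genM sub by blast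
    fix G assume "minimal_monomial_gens I G"
    then show "G = M"
      unfolding minimal_monomial_gens_def using genM sub by (metis psubsetI)
  qed
qed

end

theory Submission
  imports Defs
begin

text \<open>
  Let \<open>u = x\<^sub>a u'\<close> and \<open>v\<close> be minimal generators of \<open>\<mm>I\<close> with \<open>deg u \<le> deg v\<close>, where \<open>u'\<close> is a
  minimal generator of \<open>I\<close>, and let \<open>i\<close> be a position with \<open>v\<^sub>i < u\<^sub>i\<close>. Two ways of writing
  \<open>v = x\<^sub>b v'\<close> with \<open>v' \<in> I\<close> settle the exchange at once:

  \<^item> If \<open>v\<^sub>b > u\<^sub>b\<close>, the factor \<open>x\<^sub>b\<close> itself can be exchanged for \<open>x\<^sub>i\<close>, since \<open>x\<^sub>i v' \<in> \<mm>I\<close>.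

  \<^item> If \<open>b = a\<close>, then \<open>u\<close> and \<open>v\<close> arise from \<open>u'\<close> and \<open>v'\<close> by the same factor, so \<open>u - v = u' - v'\<close>
    on exponents and the exchange in \<open>I\<close> for \<open>u'\<close>, \<open>v'\<close> can be multiplied by \<open>x\<^sub>a\<close>.

  The remaining case, \<open>b \<noteq> a\<close> and \<open>v\<^sub>b \<le> u\<^sub>b\<close>, reduces to these two by changing the factorization.
  There \<open>v'\<^sub>b < u'\<^sub>b\<close>, so the exchange property of \<open>I\<close>, used at position \<open>b\<close> rather than \<open>i\<close>, gives a
  \<open>j\<close> with \<open>v'\<^sub>j > u'\<^sub>j\<close> and \<open>z = x\<^sub>b v' / x\<^sub>j \<in> I\<close>. In the new factorization \<open>v = x\<^sub>j z\<close> either \<open>j = a\<close>, or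
  \<open>u\<^sub>j = u'\<^sub>j < v'\<^sub>j \<le> v\<^sub>j\<close>.

  The exchange property of \<open>I\<close> speaks of minimal generators of \<open>I\<close> only. It applies to the
  cofactors \<open>u'\<close>, \<open>v'\<close> and \<open>z\<close> by \<open>min_gens_max_ideal_mult_cofactor\<close>: if dividing a minimal generator
  of \<open>\<mm>I\<close> by a variable gives an element of \<open>I\<close>, that element is a minimal generator of \<open>I\<close>.
\<close>

section \<open>Minimal generators and divisibility\<close>

lemma minimal_monomial_gens_min_gens:
  fixes I :: "('n::finite, 'k::field) mpoly set"
  assumes "monomial_ideal I"
  shows "minimal_monomial_gens I (min_gens I)"
  unfolding min_gens_def using ex1_minimal_monomial_gens[OF assms] by (rule theI')

lemma monom_mem_iff_min_gens:
  fixes I :: "('n::finite, 'k::field) mpoly set"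
  assumes "monomial_ideal I"
  shows "monom u \<in> I \<longleftrightarrow> (\<exists>g\<in>min_gens I. \<exists>c. u = g + c)"
  using minimal_monomial_gens_min_gens[OF assms] monom_mem_ideal_gen_iff[of u "min_gens I"]
  unfolding minimal_monomial_gens_def by metis

lemma monom_mem_if_min_gens:
  fixes I :: "('n::finite, 'k::field) mpoly set"
  assumes "monomial_ideal I" "g \<in> min_gens I"
  shows "monom g \<in> I"
proof -
  have "g = g + 0" by simp
  then show ?thesis using assms(2) unfolding monom_mem_iff_min_gens[OF assms(1)] by blast
qed

text \<open>A generator divisible by another one is redundant, so minimality forbids divisibility.\<close>

lemma min_gens_antichain:
  fixes I :: "('n::finite, 'k::field) mpoly set"
  assumes I: "monomial_ideal I" and "g \<in> min_gens I" "g + c \<in> min_gens I"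
  shows "c = 0"
proof (rule ccontr)
  assume "c \<noteq> 0"
  let ?H = "min_gens I - {g + c}"
  have "g \<in> ?H" using assms \<open>c \<noteq> 0\<close> by simp
  then have "(monom (g + c) :: ('n, 'k) mpoly) \<in> ideal_gen (monom ` ?H)"
    unfolding monom_mem_ideal_gen_iff by blast
  moreover have "(monom ` ?H :: ('n, 'k) mpoly set) \<subseteq> ideal_gen (monom ` ?H)"
    unfolding ideal_gen_def by (rule ideal.span_superset)
  ultimately have "(monom ` min_gens I :: ('n, 'k) mpoly set) \<subseteq> ideal_gen (monom ` ?H)"
    by blast
  then have "(ideal_gen (monom ` min_gens I) :: ('n, 'k) mpoly set) \<subseteq> ideal_gen (monom ` ?H)"
    unfolding ideal_gen_def by (rule ideal.span_minimal[OF _ ideal.subspace_span])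
  moreover have "(ideal_gen (monom ` ?H) :: ('n, 'k) mpoly set) \<subseteq> ideal_gen (monom ` min_gens I)"
    unfolding ideal_gen_def by (rule ideal.span_mono) blast
  moreover have "?H \<subset> min_gens I" using assms(3) by blast
  ultimately show False
    using minimal_monomial_gens_min_gens[OF I] unfolding minimal_monomial_gens_def
    by (metis subset_antisym)
qed

lemma min_gens_divisor_eq:
  fixes I :: "('n::finite, 'k::field) mpoly set"
  assumes I: "monomial_ideal I" and "monom w \<in> I" "w + c \<in> min_gens I"
  shows "c = 0"
proof -
  obtain g d where g: "g \<in> min_gens I" "w = g + d"
    using assms(2) monom_mem_iff_min_gens[OF I] by blast
  then have "d + c = 0" using min_gens_antichain[OF I g(1)] assms(3) by (simp add: add.assoc)
  then have "expo d k + expo c k = 0" for k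
    by (metis lookup_add lookup_zero)
  then show ?thesis by (intro poly_mapping_eqI) simp
qed

section \<open>Products with the graded maximal ideal\<close>

lemma ideal_mult_ideal_gen:
  fixes A B :: "('n, 'k::field) mpoly set"
  shows "ideal_mult (ideal_gen A) (ideal_gen B) = ideal_gen {a * b | a b. a \<in> A \<and> b \<in> B}"
    (is "_ = ideal_gen ?AB")
proof (rule subset_antisym)
  have "p * q \<in> ideal_gen ?AB" if p: "p \<in> ideal_gen A" and q: "q \<in> ideal_gen B" for p q
  proof -
    have left: "a * q \<in> ideal_gen ?AB" if "a \<in> A" for a
      using q unfolding ideal_gen_def
    proof (induction rule: ideal.span_induct_alt)
      case base
      show ?case by (simp add: ideal.span_zero)
    next
      case (step c b r)
      have "a * b \<in> module.span (*) ?AB" using \<open>a \<in> A\<close> step(1) by (blast intro: ideal.span_base)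
      then have "c * (a * b) + a * r \<in> module.span (*) ?AB"
        by (rule ideal.span_add[OF ideal.span_scale step(2)])
      moreover have "a * (c * b + r) = c * (a * b) + a * r"
        by (simp only: distrib_left mult.left_commute)
      ultimately show ?case by (simp only:)
    qed
    show ?thesis
      using p unfolding ideal_gen_def
    proof (induction rule: ideal.span_induct_alt)
      case base
      show ?case by (simp add: ideal.span_zero)
    next
      case (step c a r)
      have "c * (a * q) + r * q \<in> module.span (*) ?AB"
        by (rule ideal.span_add[OF ideal.span_scale[OF left[unfolded ideal_gen_def, OF step(1)]] step(2)])
      then show ?case by (simp only: distrib_right mult.assoc)
    qed
  qed
  then show "ideal_mult (ideal_gen A) (ideal_gen B) \<subseteq> ideal_gen ?AB"
    unfolding ideal_mult_def
    by (unfold ideal_gen_def) (rule ideal.span_minimal, blast, rule ideal.subspace_span)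
  show "ideal_gen ?AB \<subseteq> ideal_mult (ideal_gen A) (ideal_gen B)"
    unfolding ideal_mult_def ideal_gen_def
    by (rule ideal.span_mono) (blast intro: ideal.span_base)
qed

lemma max_ideal_mult_eq_ideal_gen:
  "ideal_mult max_ideal (ideal_gen (monom ` A)) =
     (ideal_gen (monom ` {var i + a | i a. a \<in> A}) :: ('n, 'k::field) mpoly set)"
proof -
  have "monom (var i) * monom a = (monom (var i + a) :: ('n, 'k) mpoly)" for i a
    by (simp add: monom_def mult_single)
  then have "{p * q | p q. p \<in> range (\<lambda>i. monom (var i)) \<and> q \<in> monom ` A} =
      (monom ` {var i + a | i a. a \<in> A} :: ('n, 'k) mpoly set)"
    by (auto simp: image_iff) metis+
  then show ?thesis unfolding max_ideal_def ideal_mult_ideal_gen by simp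
qed

lemma monomial_ideal_max_ideal_mult:
  fixes I :: "('n, 'k::field) mpoly set"
  assumes "monomial_ideal I"
  shows "monomial_ideal (ideal_mult max_ideal I)"
proof -
  obtain A where A: "I = ideal_gen (monom ` A)"
    using assms unfolding monomial_ideal_def by blast
  show ?thesis
    unfolding monomial_ideal_def A max_ideal_mult_eq_ideal_gen by (rule exI) (rule refl)
qed

lemma monom_mem_max_ideal_mult_iff:
  fixes I :: "('n, 'k::field) mpoly set"
  assumes "monomial_ideal I"
  shows "monom w \<in> ideal_mult max_ideal I \<longleftrightarrow> (\<exists>i z. w = var i + z \<and> monom z \<in> I)"
proof -
  obtain A where A: "I = ideal_gen (monom ` A)"
    using assms unfolding monomial_ideal_def by blast
  have "monom w \<in> ideal_mult max_ideal I \<longleftrightarrow> (\<exists>i. \<exists>a\<in>A. \<exists>c. w = var i + (a + c))"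
    unfolding A max_ideal_mult_eq_ideal_gen monom_mem_ideal_gen_iff by (force simp: add.assoc)
  also have "\<dots> \<longleftrightarrow> (\<exists>i z. w = var i + z \<and> monom z \<in> I)"
    unfolding A monom_mem_ideal_gen_iff by blast
  finally show ?thesis .
qed

text \<open>
  Were \<open>z\<close> a proper multiple of some \<open>g \<in> I\<close>, then \<open>x\<^sub>a g \<in> \<mm>I\<close> would properly divide \<open>x\<^sub>a z\<close>.
\<close>

lemma min_gens_max_ideal_mult_cofactor:
  fixes I :: "('n::finite, 'k::field) mpoly set"
  assumes I: "monomial_ideal I" and "var a + z \<in> min_gens (ideal_mult max_ideal I)"
    and "monom z \<in> I"
  shows "z \<in> min_gens I"
proof -
  obtain g c where g: "g \<in> min_gens I" "z = g + c"
    using assms(3) monom_mem_iff_min_gens[OF I] by blast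
  have "monom g \<in> I" by (rule monom_mem_if_min_gens[OF I g(1)])
  then have "monom (var a + g) \<in> ideal_mult max_ideal I"
    unfolding monom_mem_max_ideal_mult_iff[OF I] by blast
  then have "c = 0"
    using min_gens_divisor_eq[OF monomial_ideal_max_ideal_mult[OF I]] assms(2) g(2)
    by (simp add: add.assoc)
  then show ?thesis using g by simp
qed

lemma min_gens_max_ideal_mult_obtain:
  fixes I :: "('n::finite, 'k::field) mpoly set"
  assumes I: "monomial_ideal I" and w: "w \<in> min_gens (ideal_mult max_ideal I)"
  obtains a z where "w = var a + z" "z \<in> min_gens I"
proof -
  have "monom w \<in> ideal_mult max_ideal I"
    by (rule monom_mem_if_min_gens[OF monomial_ideal_max_ideal_mult[OF I] w])
  then obtain a z where z: "w = var a + z" "monom z \<in> I"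
    unfolding monom_mem_max_ideal_mult_iff[OF I] by blast
  show ?thesis
    by (rule that[OF z(1) min_gens_max_ideal_mult_cofactor[OF I w[unfolded z(1)] z(2)]])
qed

section \<open>The exchange property\<close>

lemma expo_var_add: "expo (var a + z) k = expo z k + (if k = a then 1 else 0)"
  by (simp add: var_def lookup_add lookup_single when_def)

lemma mdeg_var_add: "mdeg (var a + z) = Suc (mdeg z)"
  unfolding mdeg_def expo_var_add by (simp add: sum.distrib)

lemma split_var:
  assumes "expo v j > 0"
  obtains r where "v = var j + r"
proof
  show "v = var j + (v - var j)"
    using assms
    by (intro poly_mapping_eqI)
      (auto simp: lookup_add lookup_minus var_def lookup_single when_def)
qed

lemma nonpure_dual_exchangeD:
  assumes "nonpure_dual_exchange I" "u \<in> min_gens I" "v \<in> min_gens I"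
    and "mdeg u \<le> mdeg v" "expo v i < expo u i"
  obtains j r where "v = var j + r" "expo u j < expo v j" "monom (var i + r) \<in> I"
proof -
  obtain j where j: "expo u j < expo v j" "monom (v - var j + var i) \<in> I"
    using assms unfolding nonpure_dual_exchange_def by blast
  then obtain r where "v = var j + r" using split_var[of v j] by auto
  then show ?thesis using that j by (simp add: add.commute)
qed

theorem proposition1p4:
  fixes I :: "('n::finite, 'k::field) mpoly set"
  assumes "nonpure_dual_exchange I"
  shows "nonpure_dual_exchange (ideal_mult max_ideal I)"
proof -
  let ?J = "ideal_mult max_ideal I"
  have I: "monomial_ideal I" using assms unfolding nonpure_dual_exchange_def by blast
  have "\<exists>j. expo v j > expo u j \<and> monom (v - var j + var i) \<in> ?J"
    if u: "u \<in> min_gens ?J" and v: "v \<in> min_gens ?J" and uv: "mdeg u \<le> mdeg v"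
      and i: "expo v i < expo u i" for u v i
  proof -
    obtain a u' where u': "u = var a + u'" "u' \<in> min_gens I"
      using min_gens_max_ideal_mult_obtain[OF I u] by blast
    obtain b v' where v': "v = var b + v'" "v' \<in> min_gens I"
      using min_gens_max_ideal_mult_obtain[OF I v] by blast
    have surplus_factor: ?thesis
      if "v = var k + z" "monom z \<in> I" "expo v k > expo u k" for k z
    proof -
      have "monom (v - var k + var i) \<in> ?J"
        using that unfolding monom_mem_max_ideal_mult_iff[OF I]
        by (metis add.commute add_diff_cancel_left')
      then show ?thesis using that(3) by blast
    qed
    have common_factor: ?thesis if z: "v = var a + z" "z \<in> min_gens I" for z
    proof -
      have "mdeg u' \<le> mdeg z" "expo z i < expo u' i"
        using uv i unfolding u'(1) z(1) mdeg_var_add expo_var_add by auto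
      then obtain j r where j: "z = var j + r" "expo u' j < expo z j" "monom (var i + r) \<in> I"
        using nonpure_dual_exchangeD[OF assms u'(2) z(2)] by blast
      have "v - var j + var i = var a + (var i + r)"
        unfolding z(1) j(1) add.left_commute[of "var a" "var j"] add_diff_cancel_left'
        by (simp add: ac_simps)
      then have "monom (v - var j + var i) \<in> ?J"
        using j(3) unfolding monom_mem_max_ideal_mult_iff[OF I] by blast
      moreover have "expo v j > expo u j"
        using j(2) unfolding u'(1) z(1) expo_var_add by simp
      ultimately show ?thesis by blast
    qed
    have v'I: "monom v' \<in> I" by (rule monom_mem_if_min_gens[OF I v'(2)])
    consider "expo v b > expo u b" | "b = a" | "b \<noteq> a" "expo v b \<le> expo u b" by linarith
    then show ?thesis
    proof cases
      case 1
      then show ?thesis using surplus_factor v'(1) v'I by blast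
    next
      case 2
      then show ?thesis using common_factor v' by blast
    next
      case 3
      then have "mdeg u' \<le> mdeg v'" "expo v' b < expo u' b"
        using uv unfolding u'(1) v'(1) mdeg_var_add expo_var_add by auto
      then obtain j r where j: "v' = var j + r" "expo u' j < expo v' j" "monom (var b + r) \<in> I"
        using nonpure_dual_exchangeD[OF assms u'(2) v'(2)] by blast
      have v_eq: "v = var j + (var b + r)" unfolding v'(1) j(1) by (rule add.left_commute)
      show ?thesis
      proof (cases "j = a")
        case True
        then have "var b + r \<in> min_gens I"
          using min_gens_max_ideal_mult_cofactor[OF I] v v_eq j(3) by blast
        then show ?thesis using common_factor v_eq True by blast
      next
        case False
        then have "expo v j > expo u j"
          using j(2) unfolding u'(1) v'(1) expo_var_add by simp
        then show ?thesis using surplus_factor v_eq j(3) by blast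
      qed
    qed
  qed
  then show ?thesis
    unfolding nonpure_dual_exchange_def using monomial_ideal_max_ideal_mult[OF I] by blast
qed

end
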